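(* Let $A_1,\dots,A_k$ be Hermitian $m\times m$ matrices that are linearly independent over $\mathbb{R}$. Then there exist $\lambda\in\mathbb{R}^k$ and $v\in\mathbb{C}^m$ such that, with $X=\sum_{j=1}^k\lambda_jA_j$ and $S=S(X,v)=\operatorname{Span}_{\mathbb{C}}\{X^\ell v:\ell=0,1,2,\dots\}\subset\mathbb{C}^m$, the linear operators $S\to\mathbb{C}^m$ defined by the matrices $A_1,\dots,A_k$ (i.e. the restrictions $A_j|_S$) are linearly independent over $\mathbb{R}$. *)

theory Defs
  imports "HOL-Analysis.Analysis"
begin

definition hermitian :: "complex ^ 'm ^ 'm \<Rightarrow> bool" where
  "hermitian A \<longleftrightarrow> (\<forall>i j. A $ i $ j = cnj (A $ j $ i))"

primrec matpow :: "'a::semiring_1 ^ 'm ^ 'm \<Rightarrow> nat \<Rightarrow> 'a ^ 'm ^ 'm" where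
  "matpow X 0 = mat 1"
| "matpow X (Suc l) = X ** matpow X l"

text \<open>The library's \<open>vec.span\<close> is the span over the field of entries, here \<open>\<complex>\<close>;
  plain \<open>span\<close> would be the real span.\<close>

definition krylov :: "complex ^ 'm ^ 'm \<Rightarrow> complex ^ 'm \<Rightarrow> (complex ^ 'm) set" where
  "krylov X v = vec.span {matpow X l *v v | l. True}"

text \<open>Linear independence over the reals of families (not of their underlying sets, so a repeated
  member makes a family dependent) indexed by \<open>1, \<dots>, k\<close>.  The second notion is for
  maps \<open>f\<^sub>1, \<dots>, f\<^sub>k\<close> restricted to \<open>S\<close>, under pointwise operations: a linear
  combination is the zero map on \<open>S\<close> iff it vanishes at every point of \<open>S\<close>.\<close>

definition lin_indep_family :: "nat \<Rightarrow> (nat \<Rightarrow> 'a::real_vector) \<Rightarrow> bool" where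
  "lin_indep_family k f \<longleftrightarrow>
     (\<forall>c :: nat \<Rightarrow> real. (\<Sum>j = 1..k. c j *\<^sub>R f j) = 0 \<longrightarrow> (\<forall>j\<in>{1..k}. c j = 0))"

definition lin_indep_maps_on :: "'b set \<Rightarrow> nat \<Rightarrow> (nat \<Rightarrow> 'b \<Rightarrow> 'a::real_vector) \<Rightarrow> bool" where
  "lin_indep_maps_on S k f \<longleftrightarrow>
     (\<forall>c :: nat \<Rightarrow> real. (\<forall>w\<in>S. (\<Sum>j = 1..k. c j *\<^sub>R f j w) = 0) \<longrightarrow> (\<forall>j\<in>{1..k}. c j = 0))"

end

theory Submission
  imports Defs
begin

text \<open>Choose \<open>X\<close> in the real span of the \<open>A\<^sub>j\<close> and \<open>v\<close> such that the Krylov space \<open>S\<close> has maximal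
  dimension.  If some nonzero \<open>B\<close> in that span vanished on \<open>S\<close>, then some \<open>X + t B\<close> would have an
  eigenvalue \<open>\<mu>\<close> exceeding the norm of \<open>X\<close>, with an eigenvector \<open>w\<close>.  Since \<open>X + t B\<close> agrees
  with \<open>X\<close> on \<open>S\<close>, \<open>w\<close> lies outside \<open>S\<close> and \<open>X - \<mu>\<close> is invertible on \<open>S\<close>.  The Krylov space of
  \<open>X + t B\<close> and \<open>v + w\<close> contains \<open>(X + t B - \<mu>) (v + w) = (X - \<mu>) v\<close>, hence
  \<open>(X - \<mu>) S = S\<close>, hence also \<open>w\<close>, which contradicts maximality.\<close>

text \<open>The quadratic form attains its maximum on the compact unit sphere, and vanishing of its
  first variation at a maximizer is the eigenvector equation.\<close>

lemma selfadjoint_max_eigenvector: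
  fixes f :: "'a::euclidean_space \<Rightarrow> 'a"
  assumes lin: "linear f" and sa: "\<And>x y. x \<bullet> f y = f x \<bullet> y"
  obtains \<mu> w where "w \<noteq> 0" "f w = \<mu> *\<^sub>R w" "\<And>x. x \<bullet> f x \<le> \<mu> * (x \<bullet> x)"
proof -
  interpret linear f by (fact lin)
  have "continuous_on (sphere 0 1) (\<lambda>x. x \<bullet> f x)"
    using lin by (intro continuous_on_inner continuous_on_id linear_continuous_on) (simp add: linear_conv_bounded_linear)
  moreover have "sphere (0::'a) 1 \<noteq> {}" by simp
  ultimately obtain w where w: "w \<in> sphere 0 1"
    and max: "\<And>x. x \<in> sphere 0 1 \<Longrightarrow> x \<bullet> f x \<le> w \<bullet> f w"
    using continuous_attains_sup[OF compact_sphere, of 0 1 "\<lambda>x. x \<bullet> f x"] by blast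
  define \<mu> where "\<mu> = w \<bullet> f w"
  have ww: "w \<bullet> w = 1" using w by (simp add: dot_square_norm)
  have le: "x \<bullet> f x \<le> \<mu> * (x \<bullet> x)" for x
  proof (cases "x = 0")
    case False
    then have "(x /\<^sub>R norm x) \<bullet> f (x /\<^sub>R norm x) \<le> \<mu>"
      unfolding \<mu>_def by (intro max) simp
    then have "(x \<bullet> f x) / (norm x)\<^sup>2 \<le> \<mu>"
      by (simp add: scale power2_eq_square divide_inverse algebra_simps)
    then show ?thesis
      using False by (simp add: dot_square_norm divide_le_eq)
  qed simp
  have "u \<bullet> (f w - \<mu> *\<^sub>R w) = 0" for u
  proof -
    define b where "b = u \<bullet> (f w - \<mu> *\<^sub>R w)"
    define a where "a = \<mu> * (u \<bullet> u) - u \<bullet> f u"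
    \<comment> \<open>Expand \<open>le\<close> at \<open>w + s *\<^sub>R u\<close>; the terms of
      order zero in \<open>s\<close> cancel because \<open>w\<close> attains the maximum.\<close>
    have ineq: "2 * s * b \<le> s\<^sup>2 * a" for s
    proof -
      have "w \<bullet> f u = u \<bullet> f w"
        using sa[of w u] by (simp add: inner_commute)
      then show ?thesis
        using le[of "w + s *\<^sub>R u"] ww
        by (simp add: add scale inner_add_left inner_add_right inner_diff_right b_def a_def
            \<mu>_def[symmetric] inner_commute[of w u] power2_eq_square algebra_simps)
    qed
    have a: "a \<ge> 0" using le[of u] by (simp add: a_def)
    \<comment> \<open>For small \<open>s\<close> the linear term would dominate unless
      \<open>b = 0\<close>. The choice \<open>s = b / (a + 1)\<close> makes this explicit, with a
      positive denominator even when \<open>a = 0\<close>.\<close>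
    have "2 * b * b / (a + 1) \<le> b * b * a / (a + 1)\<^sup>2"
      using ineq[of "b / (a + 1)"] by (simp add: power2_eq_square)
    also have "\<dots> \<le> b * b / (a + 1)"
      using a by (simp add: power2_eq_square divide_simps mult_left_mono)
    finally have "b * b \<le> 0"
      using a by (simp add: divide_simps split: if_splits)
    then show ?thesis
      using b_def by (metis mult_le_0_iff order_antisym linorder_linear)
  qed
  then have "f w = \<mu> *\<^sub>R w"
    by (metis inner_eq_zero_iff right_minus_eq)
  moreover have "w \<noteq> 0"
    using ww by auto
  ultimately show thesis
    using that le by blast
qed

text \<open>Polarization at \<open>x\<close> and \<open>f x\<close>: the cross terms of the form at
  \<open>x + f x\<close> add up to twice \<open>f x \<bullet> f x\<close>.\<close>

lemma selfadjoint_quadratic_form_eq_0: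
  fixes f :: "'a::euclidean_space \<Rightarrow> 'a"
  assumes lin: "linear f" and sa: "\<And>x y. x \<bullet> f y = f x \<bullet> y"
    and null: "\<And>x. x \<bullet> f x = 0"
  shows "f x = 0"
proof -
  interpret linear f by (fact lin)
  have "f x \<bullet> f x = 0"
    using null[of "x + f x"] null[of x] null[of "f x"] sa[of "x" "f x"]
    by (simp add: add inner_add_left inner_add_right)
  then show ?thesis by simp
qed

lemma scaleR_matrix_vector_mult:
  "(c *\<^sub>R A) *v x = c *\<^sub>R (A *v x)" for A :: "complex ^ 'n ^ 'm"
  by (simp add: matrix_vector_mult_def vec_eq_iff scaleR_sum_right)

lemma sum_matrix_vector_mult:
  "(\<Sum>j\<in>I. F j) *v x = (\<Sum>j\<in>I. F j *v x)"
  by (induction I rule: infinite_finite_induct) (simp_all add: matrix_vector_mult_add_rdistrib)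

text \<open>Here \<open>\<bullet>\<close> is the real part of the Hermitian product, so the results
  on real Euclidean spaces apply to complex vectors.\<close>

lemma hermitian_selfadjoint:
  assumes "hermitian A"
  shows "x \<bullet> (A *v y) = (A *v x) \<bullet> y"
proof -
  have "x \<bullet> (A *v y) = (\<Sum>i\<in>UNIV. \<Sum>j\<in>UNIV. x $ i \<bullet> (A $ i $ j * y $ j))"
    by (simp add: inner_vec_def matrix_vector_mult_def inner_sum_right)
  also have "\<dots> = (\<Sum>i\<in>UNIV. \<Sum>j\<in>UNIV. (A $ j $ i * x $ i) \<bullet> y $ j)"
  proof (intro sum.cong refl)
    fix i j
    have "A $ i $ j = cnj (A $ j $ i)"
      using assms unfolding hermitian_def by blast
    then show "x $ i \<bullet> (A $ i $ j * y $ j) = (A $ j $ i * x $ i) \<bullet> y $ j"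
      by (simp add: inner_complex_def algebra_simps)
  qed
  also have "\<dots> = (\<Sum>j\<in>UNIV. \<Sum>i\<in>UNIV. (A $ j $ i * x $ i) \<bullet> y $ j)"
    by (rule sum.swap)
  also have "\<dots> = (A *v x) \<bullet> y"
    by (simp add: inner_vec_def matrix_vector_mult_def inner_sum_left)
  finally show ?thesis .
qed

lemma hermitian_scaleR: "hermitian A \<Longrightarrow> hermitian (c *\<^sub>R A)"
  unfolding hermitian_def vector_scaleR_component by (metis complex_cnj_scaleR)

lemma hermitian_sum:
  assumes "\<And>j. j \<in> I \<Longrightarrow> hermitian (F j)"
  shows "hermitian (\<Sum>j\<in>I. F j)"
  using assms unfolding hermitian_def sum_component cnj_sum by (metis (no_types, lifting) sum.cong)

lemma hermitian_add: "hermitian A \<Longrightarrow> hermitian B \<Longrightarrow> hermitian (A + B)"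
  unfolding hermitian_def vector_add_component complex_cnj_add by metis

text \<open>Krylov spaces are complex, but their sizes are compared below by the real dimension
  \<open>dim\<close>.\<close>

lemma vec_subspace_imp_subspace:
  fixes S :: "(complex ^ 'm) set"
  assumes "vec.subspace S"
  shows "subspace S"
proof -
  have "c *\<^sub>R x = complex_of_real c *s x" for c and x :: "complex ^ 'm"
    by (simp add: vec_eq_iff scaleR_conv_of_real[where 'a = complex])
  with assms show ?thesis
    by (simp add: subspace_def vec.subspace_def)
qed

lemma vec_subspace_krylov: "vec.subspace (krylov X v)"
  by (simp add: krylov_def)

lemma subspace_krylov: "subspace (krylov X v)"
  by (simp add: vec_subspace_imp_subspace vec_subspace_krylov)

lemma krylov_base: "v \<in> krylov X v"
proof -
  have "matpow X 0 *v v \<in> krylov X v"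
    unfolding krylov_def by (rule vec.span_base) blast
  then show ?thesis by simp
qed

lemma krylov_step:
  assumes "x \<in> krylov X v"
  shows "X *v x \<in> krylov X v"
  using assms unfolding krylov_def
proof (induction rule: vec.span_induct_alt)
  case base
  then show ?case by (simp add: vec.span_zero)
next
  case (step c x y)
  then obtain l where "x = matpow X l *v v" by blast
  then have "X *v x = matpow X (Suc l) *v v"
    by (simp add: matrix_vector_mul_assoc)
  then have "X *v x \<in> vec.span {matpow X l *v v |l. True}"
    by (intro vec.span_base) blast
  with step.IH show ?case
    by (simp add: matrix_vector_right_distrib vector_scalar_commute vec.span_add vec.span_scale)
qed

text \<open>Invariance of \<open>T\<close> is asked only at points of the Krylov space, since in the
  application two matrices agree only there. The induction therefore carries both
  memberships.\<close>

lemma krylov_minimal: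
  assumes "vec.subspace T" "v \<in> T" "\<And>x. x \<in> T \<Longrightarrow> x \<in> krylov X v \<Longrightarrow> X *v x \<in> T"
  shows "krylov X v \<subseteq> T"
proof -
  have "matpow X l *v v \<in> T \<inter> krylov X v" for l
    by (induction l)
       (use assms in \<open>auto simp: krylov_base krylov_step simp flip: matrix_vector_mul_assoc\<close>)
  then show ?thesis
    unfolding krylov_def by (intro vec.span_minimal) (auto simp: assms)
qed

lemma krylov_dim_increase:
  fixes X B :: "complex ^ 'm ^ 'm"
  assumes X: "hermitian X" and B: "hermitian B" "B \<noteq> 0"
    and van: "\<And>w. w \<in> krylov X v \<Longrightarrow> B *v w = 0"
  obtains t v' where "dim (krylov X v) < dim (krylov (X + t *\<^sub>R B) v')"
proof -
  let ?S = "krylov X v"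
  have "\<exists>u. u \<bullet> (B *v u) \<noteq> 0"
  proof (rule ccontr)
    assume "\<not> ?thesis"
    then have "B *v x = 0" for x
      using selfadjoint_quadratic_form_eq_0[OF matrix_vector_mul_linear
          hermitian_selfadjoint[OF B(1)]] by blast
    then show False
      using B(2) by (simp add: matrix_eq)
  qed
  then obtain u where u: "u \<bullet> (B *v u) \<noteq> 0" ..
  then have u0: "u \<bullet> u > 0" by auto
  obtain K where K: "\<And>x. norm (X *v x) \<le> K * norm x"
    using linear_bounded[OF matrix_vector_mul_linear] by blast
  \<comment> \<open>Solves \<open>u \<bullet> (M *v u) = (K + 1) * (u \<bullet> u)\<close> for
    \<open>t\<close>, so the top eigenvalue of \<open>M\<close> is at least \<open>K + 1\<close>.
    Either sign of \<open>u \<bullet> (B *v u)\<close> is fine, as \<open>t\<close> may be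
    negative.\<close>
  define t where "t = ((K + 1) * (u \<bullet> u) - u \<bullet> (X *v u)) / (u \<bullet> (B *v u))"
  define M where "M = X + t *\<^sub>R B"
  have M: "M *v x = X *v x + t *\<^sub>R (B *v x)" for x
    by (simp add: M_def matrix_vector_mult_add_rdistrib scaleR_matrix_vector_mult)
  have MX: "M *v x = X *v x" if "x \<in> ?S" for x
    using van[OF that] by (simp add: M)
  have "hermitian M"
    unfolding M_def by (intro hermitian_add hermitian_scaleR X B)
  then obtain \<mu> w where w: "w \<noteq> 0" "M *v w = \<mu> *\<^sub>R w" and \<mu>: "\<And>x. x \<bullet> (M *v x) \<le> \<mu> * (x \<bullet> x)"
    using selfadjoint_max_eigenvector[OF matrix_vector_mul_linear]
      hermitian_selfadjoint by metis
  have "(K + 1) * (u \<bullet> u) \<le> \<mu> * (u \<bullet> u)"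
    using \<mu>[of u] u by (simp add: M inner_add_right t_def)
  then have "\<mu> > K"
    using u0 by simp
  \<comment> \<open>An eigenvalue of \<open>X\<close> cannot exceed the bound \<open>K\<close>; this
    also gives injectivity of \<open>g\<close> below.\<close>
  then have eig: "x = 0" if "X *v x = \<mu> *\<^sub>R x" for x
  proof -
    have "\<mu> * norm x \<le> K * norm x"
      using K[of x] that abs_ge_self[of \<mu>] mult_right_mono[of \<mu> "\<bar>\<mu>\<bar>" "norm x"] by simp
    with \<open>\<mu> > K\<close> show ?thesis
      by (simp add: mult_le_cancel_right)
  qed
  have "w \<notin> ?S"
    using w MX eig by metis
  let ?T = "krylov M (v + w)"
  note T = subspace_krylov[of M "v + w"]
  define g where "g x = X *v x - \<mu> *\<^sub>R x" for x
  have lin: "linear g"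
    unfolding g_def by (intro linear_compose_sub matrix_vector_mul_linear linear_scale_self)
  \<comment> \<open>An injective linear map of a finite-dimensional space into itself is
    onto.\<close>
  have gS: "g ` ?S = ?S"
  proof (rule subspace_dim_equal)
    show "subspace (g ` ?S)"
      by (intro linear_subspace_image lin subspace_krylov)
    show "g ` ?S \<subseteq> ?S"
      by (auto simp: g_def intro!: subspace_diff subspace_scale subspace_krylov krylov_step)
    have "inj g"
      using lin eig by (auto simp: linear_injective_0 g_def)
    then show "dim ?S \<le> dim (g ` ?S)"
      using dim_image_eq[OF lin] by (simp add: inj_on_subset)
  qed (rule subspace_krylov)
  \<comment> \<open>It is not yet known that \<open>v\<close> lies in \<open>?T\<close>, but
    \<open>g v\<close> does; so the inclusion is first proved for the images under
    \<open>g\<close>.\<close>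
  have "?S \<subseteq> {x. g x \<in> ?T}"
  proof (rule krylov_minimal)
    have "g (c *s x) = c *s g x" for c x
      by (simp add: g_def vector_scalar_commute vec_eq_iff algebra_simps)
    then show "vec.subspace {x. g x \<in> ?T}"
      using vec_subspace_krylov[of M "v + w"] linear_0[OF lin] linear_add[OF lin]
      by (simp add: vec.subspace_def)
    \<comment> \<open>\<open>M - \<mu>\<close> annihilates \<open>w\<close> and acts on
      \<open>v\<close> as \<open>g\<close> does.\<close>
    have "g v = M *v (v + w) - \<mu> *\<^sub>R (v + w)"
      by (simp add: g_def MX krylov_base w matrix_vector_right_distrib algebra_simps)
    also have "\<dots> \<in> ?T"
      by (intro subspace_diff subspace_scale T krylov_step krylov_base)
    finally show "v \<in> {x. g x \<in> ?T}" by simp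
    fix x assume x: "x \<in> {x. g x \<in> ?T}" "x \<in> ?S"
    have "g (X *v x) = X *v g x"
      using linear_diff[OF matrix_vector_mul_linear]
        linear_scale[OF matrix_vector_mul_linear] by (metis g_def)
    \<comment> \<open>\<open>g x\<close> lies in \<open>?S\<close>, where \<open>M\<close> and
      \<open>X\<close> agree, and \<open>?T\<close> is invariant under \<open>M\<close>.\<close>
    also have "\<dots> = M *v g x"
      using x gS by (metis MX imageI)
    finally show "X *v x \<in> {x. g x \<in> ?T}"
      using x krylov_step by simp
  qed
  then have "g ` ?S \<subseteq> ?T" by blast
  then have ST: "?S \<subseteq> ?T" unfolding gS .
  have "v \<in> ?T"
    using ST krylov_base by blast
  then have "w \<in> ?T"
    using subspace_diff[OF T krylov_base, of v] by simp
  with ST \<open>w \<notin> ?S\<close> have "?S \<subset> ?T"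
    by blast
  then have "dim ?S < dim ?T"
    by (intro dim_psubset) (simp add: span_eq_iff[THEN iffD2] subspace_krylov)
  then show thesis
    using that M_def by blast
qed

theorem theorem5p3:
  fixes k :: nat and A :: "nat \<Rightarrow> complex ^ 'm ^ 'm"
  assumes "\<And>j. j \<in> {1..k} \<Longrightarrow> hermitian (A j)"
    and "lin_indep_family k A"
  shows "\<exists>(lam :: nat \<Rightarrow> real) (v :: complex ^ 'm).
           lin_indep_maps_on (krylov (\<Sum>j = 1..k. lam j *\<^sub>R A j) v) k (\<lambda>j w. A j *v w)"
proof -
  define L where "L c = (\<Sum>j = 1..k. c j *\<^sub>R A j)" for c :: "nat \<Rightarrow> real"
  have herm: "hermitian (L c)" for c
    unfolding L_def by (intro hermitian_sum hermitian_scaleR assms)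
  \<comment> \<open>Dimensions are bounded by that of the whole space, so a maximum exists; the
    \<open>Suc\<close> makes the bound strict.\<close>
  have "\<exists>p. \<forall>q. dim (krylov (L (fst q)) (snd q)) \<le> dim (krylov (L (fst p)) (snd p))"
    using ex_has_greatest_nat[where P = "\<lambda>_. True" and b = "Suc (DIM(complex ^ 'm))"
        and f = "\<lambda>p. dim (krylov (L (fst p)) (snd p))"] dim_subset_UNIV le_imp_less_Suc by blast
  then obtain lam v where max: "\<And>c u. dim (krylov (L c) u) \<le> dim (krylov (L lam) v)"
    by auto
  have "lin_indep_maps_on (krylov (L lam) v) k (\<lambda>j w. A j *v w)"
    unfolding lin_indep_maps_on_def
  proof (intro allI impI)
    fix c :: "nat \<Rightarrow> real"
    assume "\<forall>w\<in>krylov (L lam) v. (\<Sum>j = 1..k. c j *\<^sub>R (A j *v w)) = 0"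
    then have van: "\<And>w. w \<in> krylov (L lam) v \<Longrightarrow> L c *v w = 0"
      by (simp add: L_def sum_matrix_vector_mult scaleR_matrix_vector_mult)
    have "L c = 0"
    proof (rule ccontr)
      assume "L c \<noteq> 0"
      then obtain t u where "dim (krylov (L lam) v) < dim (krylov (L lam + t *\<^sub>R L c) u)"
        using krylov_dim_increase[OF herm herm _ van] by blast
      \<comment> \<open>The perturbed matrix is again a real combination of the \<open>A j\<close>,
        so maximality applies to it.\<close>
      moreover have "L lam + t *\<^sub>R L c = L (\<lambda>j. lam j + t * c j)"
        by (simp add: L_def scaleR_sum_right sum.distrib scaleR_add_left)
      ultimately show False
        using max by (metis not_le)
    qed
    then show "\<forall>j\<in>{1..k}. c j = 0"
      using assms(2) by (simp add: lin_indep_family_def L_def)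
  qed
  then show ?thesis
    unfolding L_def by blast
qed

end
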